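(* Consider the sequence game (defined in the context), in a position $(n_1,\dots,n_k)$ consisting of a finite sequence of positive integers with $\sum_{i=1}^k n_i\ge 2$. If it is White's turn (that is, $\sum_{i=1}^k n_i$ is odd), then White wins if and only if $|\Delta(n_1,\dots,n_k)|=1$. If it is Black's turn (that is, $\sum_{i=1}^k n_i$ is even), then Black wins if and only if $|\Delta(n_1,\dots,n_k)|\ne 0$.
   Context: Sequence game: a position is a finite sequence $(n_1,\dots,n_k)$ of positive integers with $\sum_{i=1}^k n_i\ge 2$. There are two players, Black and White, who alternate; it is Black's turn when $\sum n_i$ is even and White's turn when $\sum n_i$ is odd. At each turn, the player to move replaces the ordered sequence by a new one through one of the following moves: (i) replace $n_1$ by $n_1-1$, if $n_1\ge 2$; (ii) replace $n_k$ by $n_k-1$, if $n_k\ge 2$; (iii) remove some $n_i$ with $n_i=1$; (iv) choose some $n_i\ge 3$ and replace it by a pair $(n',n'')$ of positive integers (in consecutive positions) with $n'+n''=n_i-1$; (v) replace two consecutive terms $(n_i,n_{i+1})$ with $n_i+n_{i+1}\ge 3$ by the single term $n_i+n_{i+1}-1$. Each move decreases $\sum n_i$ by $1$. The game ends when $\sum n_i=2$: White is the winner if the final sequence is $(2)$, and Black is the winner if the final sequence is $(1,1)$. "A player wins" in a position means that the player has a winning strategy from that position. The integer $\Delta$ is defined by $$\Delta(n_1,\dots,n_k)=\bigl|\{i: n_i \text{ odd and } |\{j\le i: n_j \text{ even}\}| \text{ is even}\}\bigr|-\bigl|\{i: n_i \text{ odd and } |\{j\le i: n_j \text{ even}\}|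 \text{ is odd}\}\bigr|.$$ *)

theory Defs
  imports Main
begin

datatype player = Black | White

definition is_position :: "nat list \<Rightarrow> bool" where
  "is_position ns \<longleftrightarrow> (\<forall>n\<in>set ns. 0 < n) \<and> 2 \<le> sum_list ns"

definition to_move :: "nat list \<Rightarrow> player" where
  "to_move ns = (if even (sum_list ns) then Black else White)"

text \<open>The rewriting rules themselves, on sequences of positive integers;
  that the game stops as soon as the sum is 2 is imposed in \<open>complete_play\<close>.\<close>

inductive move :: "nat list \<Rightarrow> nat list \<Rightarrow> bool" where
  decrease_first: "2 \<le> n \<Longrightarrow> move (n # ys) ((n - 1) # ys)"
| decrease_last: "2 \<le> n \<Longrightarrow> move (xs @ [n]) (xs @ [n - 1])"
| remove_one: "move (xs @ 1 # ys) (xs @ ys)"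
| split_term: "3 \<le> n \<Longrightarrow> 0 < a \<Longrightarrow> 0 < b \<Longrightarrow> a + b = n - 1 \<Longrightarrow>
    move (xs @ n # ys) (xs @ a # b # ys)"
| merge_terms: "3 \<le> a + b \<Longrightarrow> move (xs @ a # b # ys) (xs @ (a + b - 1) # ys)"

text \<open>A complete play is the list of all positions visited, from the initial position
  to a final one (of sum 2).\<close>

definition complete_play :: "nat list \<Rightarrow> nat list list \<Rightarrow> bool" where
  "complete_play ns ps \<longleftrightarrow> ps \<noteq> [] \<and> hd ps = ns \<and>
     successively (\<lambda>p q. 2 < sum_list p \<and> move p q) ps \<and> sum_list (last ps) = 2"

fun won_by :: "player \<Rightarrow> nat list \<Rightarrow> bool" where
  "won_by White p \<longleftrightarrow> p = [2]"
| "won_by Black p \<longleftrightarrow> p = [1, 1]"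

text \<open>A strategy chooses a legal move in every unfinished position where the player is to move.\<close>

definition strategy :: "player \<Rightarrow> (nat list \<Rightarrow> nat list) \<Rightarrow> bool" where
  "strategy P s \<longleftrightarrow>
     (\<forall>p. is_position p \<and> 2 < sum_list p \<and> to_move p = P \<longrightarrow> move p (s p))"

definition follows :: "player \<Rightarrow> (nat list \<Rightarrow> nat list) \<Rightarrow> nat list list \<Rightarrow> bool" where
  "follows P s ps \<longleftrightarrow> successively (\<lambda>p q. to_move p = P \<longrightarrow> q = s p) ps"

text \<open>Every move lowers the sum by 1 and every position of sum at least 3 admits a move, so
  each play can be continued to a complete one: quantifying over complete plays
  loses nothing.\<close>

definition wins :: "player \<Rightarrow> nat list \<Rightarrow> bool" where
  "wins P ns \<longleftrightarrow> (\<exists>s. strategy P s \<and>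
     (\<forall>ps. complete_play ns ps \<and> follows P s ps \<longrightarrow> won_by P (last ps)))"

text \<open>Lists are indexed from 0, so \<open>ns ! i\<close> is the term $n_{i+1}$.\<close>

definition Delta :: "nat list \<Rightarrow> int" where
  "Delta ns =
     int (card {i. i < length ns \<and> odd (ns ! i) \<and> even (card {j. j \<le> i \<and> even (ns ! j)})}) -
     int (card {i. i < length ns \<and> odd (ns ! i) \<and> odd (card {j. j \<le> i \<and> even (ns ! j)})})"

end

theory Submission
  imports Defs
begin

text \<open>
  An odd term acts on the integers as the translation by 1, an even term as the reflection at 0,
  and \<open>Delta\<close> is the image of 0 under the composition, so it has the parity of the sum. Every move
  replaces \<open>Delta\<close> by \<open>Delta + 1\<close>, \<open>Delta - 1\<close> or \<open>1 - Delta\<close>; hence \<open>\<bar>Delta\<bar>\<close> changes by at most 1.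
  So Black cannot leave the value 0 except to \<open>\<bar>Delta\<bar> = 1\<close>, and White cannot reach 0 from
  \<open>\<bar>Delta\<bar> \<ge> 3\<close>. Conversely, a move at the first term or at the first even term lets White go
  from \<open>\<bar>Delta\<bar> = 1\<close> to 0 and lets Black avoid \<open>\<bar>Delta\<bar> = 1\<close> when \<open>Delta \<noteq> 0\<close>.
\<close>

section \<open>Computing Delta\<close>

lemma card_even_prefix_Cons:
  "card {j. j \<le> Suc i \<and> even ((n # ns) ! j)} =
     (if even n then 1 else 0) + card {j. j \<le> i \<and> even (ns ! j)}"
proof -
  have "{j. j \<le> Suc i \<and> even ((n # ns) ! j)} =
      (if even n then {0} else {}) \<union> Suc ` {j. j \<le> i \<and> even (ns ! j)}"
    (is "?L = ?R")
  proof (rule set_eqI)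
    fix j
    show "j \<in> ?L \<longleftrightarrow> j \<in> ?R"
      by (cases j) auto
  qed
  moreover have "finite {j. j \<le> i \<and> even (ns ! j)}"
    by simp
  ultimately show ?thesis
    by (auto simp: card_image card_insert_if)
qed

text \<open>An even head flips the parity of every later count and an odd head keeps it. The
  predicate \<open>P\<close> lets one statement serve both sets in \<open>Delta\<close>, once as the
  identity and once as negation.\<close>

lemma card_odd_terms_Cons:
  "card {i. i < length (n # ns) \<and> odd ((n # ns) ! i) \<and>
        P (even (card {j. j \<le> i \<and> even ((n # ns) ! j)}))} =
     (if odd n \<and> P True then 1 else 0) +
     card {i. i < length ns \<and> odd (ns ! i) \<and>
        P (even (card {j. j \<le> i \<and> even (ns ! j)}) \<longleftrightarrow> odd n)}"
  (is "card ?A = _ + card ?B")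
proof -
  have zero: "even (card {j. j \<le> 0 \<and> even ((n # ns) ! j)})" if "odd n"
  proof -
    have "{j. j \<le> 0 \<and> even ((n # ns) ! j)} = {}"
      using that by auto
    then show ?thesis
      by (metis card.empty even_zero)
  qed
  have shift: "even (card {j. j \<le> Suc i \<and> even ((n # ns) ! j)}) \<longleftrightarrow>
      (even (card {j. j \<le> i \<and> even (ns ! j)}) \<longleftrightarrow> odd n)" for i
    unfolding card_even_prefix_Cons by simp
  have "i \<in> ?A \<longleftrightarrow> i \<in> (if odd n \<and> P True then {0} else {}) \<union> Suc ` ?B" for i
  proof (cases i)
    case 0
    then show ?thesis
      using zero by (cases "odd n") auto
  next
    case (Suc k)
    then show ?thesis
      by (auto simp: shift)
  qed
  then have "?A = (if odd n \<and> P True then {0} else {}) \<union> Suc ` ?B"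
    by blast
  moreover have "finite ?B"
    by simp
  ultimately show ?thesis
    by (auto simp: card_image card_insert_if)
qed

lemma Delta_Nil [simp]: "Delta [] = 0"
  by (simp add: Delta_def)

lemma Delta_Cons [simp]: "Delta (n # ns) = (if odd n then 1 + Delta ns else - Delta ns)"
  unfolding Delta_def
  using card_odd_terms_Cons[of n ns "\<lambda>b. b"] card_odd_terms_Cons[of n ns "\<lambda>b. \<not> b"]
  by auto

text \<open>The linear part of the composed isometry, whose translation part is
  \<open>Delta\<close>: a change in a suffix reaches \<open>Delta\<close> multiplied by this
  sign.\<close>

definition sgn_evens :: "nat list \<Rightarrow> int" where
  "sgn_evens ns = (- 1) ^ length (filter even ns)"

lemma Delta_append [simp]: "Delta (xs @ ys) = Delta xs + sgn_evens xs * Delta ys"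
  by (induction xs) (auto simp: sgn_evens_def)

lemma sgn_evens_cases: "sgn_evens xs = 1 \<or> sgn_evens xs = - 1"
  by (simp add: sgn_evens_def minus_one_power_iff)

lemma even_Delta_iff: "even (Delta ns) \<longleftrightarrow> even (sum_list ns)"
  by (induction ns) auto

lemma Delta_all_odd: "\<forall>n\<in>set ns. odd n \<Longrightarrow> Delta ns = int (length ns)"
  by (induction ns) auto

section \<open>The effect of moves\<close>

lemma sum_list_move: "move p q \<Longrightarrow> sum_list p = Suc (sum_list q)"
  by (induction rule: move.induct) auto

lemma is_position_move:
  assumes "move p q" "is_position p" "2 < sum_list p"
  shows "is_position q"
proof -
  have "\<forall>n\<in>set q. 0 < n" if "\<forall>n\<in>set p. 0 < n"
    using assms(1) that by (induction rule: move.induct) auto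
  then show ?thesis
    using assms sum_list_move[of p q] by (auto simp: is_position_def)
qed

text \<open>Merging, splitting, removing a 1 and changing the last term each shift the local
  contribution by 1 up or down and keep the sign with which the tail enters. Only
  \<open>decrease_first\<close> reverses that sign, which gives \<open>1 - Delta p\<close>.\<close>

lemma move_Delta:
  "move p q \<Longrightarrow> Delta q = Delta p + 1 \<or> Delta q = Delta p - 1 \<or> Delta q = 1 - Delta p"
proof (induction rule: move.induct)
  case (decrease_last n xs)
  then show ?case
    using sgn_evens_cases[of xs] by auto
next
  case (remove_one xs ys)
  then show ?case
    using sgn_evens_cases[of xs] by auto
next
  case (split_term n a b xs ys)
  then have "n = Suc (a + b)"
    by simp
  then show ?case
    using sgn_evens_cases[of xs] by (auto simp: algebra_simps)
next
  case (merge_terms a b xs ys)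
  then have "even (a + b - 1) \<longleftrightarrow> odd (a + b)"
    by auto
  then show ?case
    using sgn_evens_cases[of xs] by (auto simp: algebra_simps)
qed auto

lemma move_abs_Delta: "move p q \<Longrightarrow> \<bar>\<bar>Delta q\<bar> - \<bar>Delta p\<bar>\<bar> \<le> 1"
  using move_Delta[of p q] by auto

section \<open>Moves with a prescribed effect on \<open>Delta\<close>\<close>

lemma ex_move:
  assumes "is_position p" "2 < sum_list p"
  shows "\<exists>q. move p q"
proof (cases p)
  case (Cons n ys)
  show ?thesis
  proof (cases "n = 1")
    case True
    then show ?thesis
      using Cons move.remove_one[of "[]" ys] by auto
  next
    case False
    then have "2 \<le> n"
      using assms Cons by (auto simp: is_position_def)
    then show ?thesis
      using Cons move.decrease_first by blast
  qed
qed (use assms in auto)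

lemma split_first_even:
  assumes "\<exists>n\<in>set p. even n"
  obtains xs n ys where "p = xs @ n # ys" "even n" "sgn_evens xs = 1" "\<forall>m\<in>set xs. odd m"
proof -
  obtain xs n ys where "p = xs @ n # ys" "even n" "\<forall>m\<in>set xs. odd m"
    using split_list_first_prop[OF assms] by metis
  moreover from this have "sgn_evens xs = 1"
    by (simp add: sgn_evens_def)
  ultimately show thesis
    using that by blast
qed

text \<open>Terms before the first even one leave the sign at 1, so a local gain of 1 there is a
  gain of 1 in \<open>Delta\<close>. Decreasing that term gains 1 if it is last; otherwise merging
  it with its right neighbour does, whatever the parity of the latter.\<close>

lemma ex_move_Delta_plus_1:
  assumes "is_position p" "\<exists>n\<in>set p. even n"
  shows "\<exists>q. move p q \<and> Delta q = Delta p + 1"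
proof -
  obtain xs n ys where p: "p = xs @ n # ys" "even n" "sgn_evens xs = 1"
    using split_first_even[OF assms(2)] by metis
  have "n \<noteq> 0"
    using assms(1) p by (auto simp: is_position_def)
  then have n: "2 \<le> n"
    using p(2) by (cases "n = 1") auto
  show ?thesis
  proof (cases ys)
    case Nil
    then show ?thesis
      using move.decrease_last[OF n, of xs] p n by (auto intro!: exI[of _ "xs @ [n - 1]"])
  next
    case (Cons m zs)
    have "0 < m"
      using assms(1) p Cons by (auto simp: is_position_def)
    then have "move p (xs @ (n + m - 1) # zs)" "even (n + m - 1) \<longleftrightarrow> odd (n + m)"
      using move.merge_terms[of n m xs zs] p n Cons by auto
    then show ?thesis
      using p Cons by (intro exI[of _ "xs @ (n + m - 1) # zs"]) auto
  qed
qed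

lemma ex_move_Delta_1:
  assumes "is_position p" "2 < sum_list p" "\<bar>Delta p\<bar> = 1"
  shows "\<exists>q. move p q \<and> Delta q = 0"
proof (cases "Delta p = 1")
  \<comment> \<open>Reversing the parity of the first term gives \<open>1 - Delta p = 0\<close>; a
    first term 1 is removed instead.\<close>
  case True
  obtain n ys where p: "p = n # ys"
    using assms(2) by (cases p) auto
  show ?thesis
  proof (cases "n = 1")
    case n: True
    then show ?thesis
      using p True move.remove_one[of "[]" ys] by (intro exI[of _ ys]) auto
  next
    case False
    then have "2 \<le> n"
      using assms(1) p by (auto simp: is_position_def)
    then show ?thesis
      using p True move.decrease_first[of n ys]
      by (intro exI[of _ "(n - 1) # ys"]) (auto split: if_splits)
  qed
next
  case False
  then have "Delta p = - 1"
    using assms(3) by linarith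
  \<comment> \<open>Without even terms \<open>Delta p\<close> would be a length, hence
    nonnegative.\<close>
  moreover from this have "\<exists>n\<in>set p. even n"
    using Delta_all_odd[of p] by force
  ultimately show ?thesis
    using ex_move_Delta_plus_1[OF assms(1)] by auto
qed

lemma ex_move_Delta_2:
  assumes "is_position p" "2 < sum_list p" "Delta p = 2"
  shows "\<exists>q. move p q \<and> Delta q = 3"
proof (cases "\<exists>n\<in>set p. even n")
  case True
  then show ?thesis
    using ex_move_Delta_plus_1[OF assms(1)] assms(3) by auto
next
  case False
  then have "length p = 2"
    using Delta_all_odd[of p] assms(3) by auto
  then obtain a b where p: "p = [a, b]"
    by (metis (no_types, lifting) One_nat_def Suc_1 length_0_conv length_Suc_conv)
  then have odd: "odd a" "odd b"
    using False by auto
  have "a \<noteq> 1 \<or> b \<noteq> 1"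
    using assms(2) p by auto
  \<comment> \<open>Splitting off a 1 from an odd term of size at least 3 leaves an odd rest, so
    three odd terms result.\<close>
  then have "3 \<le> a \<or> 3 \<le> b"
    using odd by (auto elim!: oddE)
  then show ?thesis
  proof
    assume "3 \<le> a"
    then have "move p [1, a - 2, b]"
      using move.split_term[of a 1 "a - 2" "[]" "[b]"] p by auto
    then show ?thesis
      using odd \<open>3 \<le> a\<close> by (intro exI[of _ "[1, a - 2, b]"]) auto
  next
    assume "3 \<le> b"
    then have "move p [a, 1, b - 2]"
      using move.split_term[of b 1 "b - 2" "[a]" "[]"] p by auto
    then show ?thesis
      using odd \<open>3 \<le> b\<close> by (intro exI[of _ "[a, 1, b - 2]"]) auto
  qed
qed

lemma ex_move_Delta_minus_2:
  assumes "is_position p" "Delta p = - 2"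
  shows "\<exists>q. move p q \<and> \<bar>Delta q\<bar> = 3"
proof -
  have "\<exists>n\<in>set p. even n"
    using Delta_all_odd[of p] assms(2) by force
  then obtain xs n ys where p: "p = xs @ n # ys" "even n" "sgn_evens xs = 1" "\<forall>m\<in>set xs. odd m"
    by (rule split_first_even)
  have "n \<noteq> 0"
    using assms(1) p by (auto simp: is_position_def)
  then have n: "2 \<le> n"
    using p(2) by (cases "n = 1") auto
  show ?thesis
  proof (cases xs rule: rev_cases)
    \<comment> \<open>Decreasing the even first term gives \<open>1 - Delta p = 3\<close>.\<close>
    case Nil
    then show ?thesis
      using move.decrease_first[OF n, of ys] p assms(2) n
      by (intro exI[of _ "(n - 1) # ys"]) auto
  next
    case (snoc zs m)
    then have m: "odd m" "0 < m"
      using p by (auto intro: odd_pos)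
    have s: "sgn_evens zs = 1"
      using p(4) snoc by (simp add: sgn_evens_def)
    \<comment> \<open>Odd \<open>m\<close> and even \<open>n\<close> merge to an even term, which
      loses the 1 contributed by \<open>m\<close>: the new value is -3.\<close>
    have "move p (zs @ (m + n - 1) # ys)" "even (m + n - 1) \<longleftrightarrow> odd (m + n)"
      using move.merge_terms[of m n zs ys] p m n snoc by auto
    then show ?thesis
      using p m s snoc assms(2) by (intro exI[of _ "zs @ (m + n - 1) # ys"]) auto
  qed
qed

section \<open>Strategies\<close>

lemma complete_play_Cons:
  "complete_play p (r # ps) \<longleftrightarrow> r = p \<and>
     (if ps = [] then sum_list p = 2
      else 2 < sum_list p \<and> move p (hd ps) \<and> complete_play (hd ps) ps)"
  by (cases ps) (auto simp: complete_play_def)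

lemma follows_Cons:
  "follows P s (p # ps) \<longleftrightarrow> ps = [] \<or> (to_move p = P \<longrightarrow> hd ps = s p) \<and> follows P s ps"
  by (cases ps) (auto simp: follows_def)

lemma complete_play_not_Nil [simp]: "\<not> complete_play p []"
  by (simp add: complete_play_def)

lemma wins_by_invariant:
  assumes "is_position ns" "Inv ns"
    and own: "\<And>p. \<lbrakk>is_position p; 2 < sum_list p; to_move p = P; Inv p\<rbrakk> \<Longrightarrow> \<exists>q. move p q \<and> Inv q"
    and opponent: "\<And>p q. \<lbrakk>is_position p; 2 < sum_list p; to_move p \<noteq> P; Inv p; move p q\<rbrakk> \<Longrightarrow> Inv q"
    and final: "\<And>p. \<lbrakk>is_position p; sum_list p = 2; Inv p\<rbrakk> \<Longrightarrow> won_by P p"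
  shows "wins P ns"
proof -
  \<comment> \<open>The implication inside the choice keeps \<open>s\<close> legal outside
    \<open>Inv\<close> too, since \<open>strategy\<close> demands a legal move in every unfinished
    position of the player.\<close>
  define s where "s p = (SOME q. move p q \<and> (Inv p \<longrightarrow> Inv q))" for p
  have s: "move p (s p) \<and> (Inv p \<longrightarrow> Inv (s p))"
    if "is_position p" "2 < sum_list p" "to_move p = P" for p
    unfolding s_def by (rule someI_ex) (use that own ex_move in blast)
  have "won_by P (last ps)"
    if "complete_play p ps" "follows P s ps" "is_position p" "Inv p" for p ps
    using that
  proof (induction ps arbitrary: p)
    case (Cons r ps)
    show ?case
    proof (cases "ps = []")
      case True
      then show ?thesis
        using Cons.prems final by (simp add: complete_play_Cons)
    next
      case False
      then have play: "r = p" "2 < sum_list p" "move p (hd ps)" "complete_play (hd ps) ps"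
          "to_move p = P \<longrightarrow> hd ps = s p" "follows P s ps"
        using Cons.prems by (auto simp: complete_play_Cons follows_Cons)
      have "Inv (hd ps)"
        using play Cons.prems s[of p] opponent[of p "hd ps"] by metis
      then show ?thesis
        using Cons.IH[of "hd ps"] play Cons.prems False is_position_move[of p "hd ps"] by simp
    qed
  qed simp
  then show ?thesis
    unfolding wins_def strategy_def using s assms(1,2) by blast
qed

section \<open>Incompatibility of winning strategies\<close>

lemma ex_play_following_both:
  assumes "strategy White s" "strategy Black t" "is_position p"
  shows "\<exists>ps. complete_play p ps \<and> follows White s ps \<and> follows Black t ps"
  using assms(3)
proof (induction "sum_list p" arbitrary: p rule: less_induct)
  case less
  show ?case
  proof (cases "sum_list p = 2")
    case True
    then show ?thesis
      by (intro exI[of _ "[p]"]) (simp add: complete_play_Cons follows_Cons)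
  next
    case False
    then have big: "2 < sum_list p"
      using less.prems by (simp add: is_position_def)
    define q where "q = (if to_move p = White then s p else t p)"
    have q: "move p q"
      using assms(1,2) less.prems big player.exhaust[of "to_move p"]
      by (auto simp: strategy_def q_def)
    obtain ps where ps: "complete_play q ps" "follows White s ps" "follows Black t ps"
      using less.hyps[of q] sum_list_move[OF q] is_position_move[OF q less.prems big] by auto
    then have "hd ps = q" "ps \<noteq> []"
      by (auto simp: complete_play_def)
    then show ?thesis
      using ps q big by (intro exI[of _ "p # ps"]) (auto simp: complete_play_Cons follows_Cons q_def)
  qed
qed

text \<open>Playing the two strategies against each other would produce a final position won by both
  players.\<close>

lemma not_wins_both:
  assumes "is_position p" "wins White p" "wins Black p"
  shows False
proof -
  obtain s t where st: "strategy White s" "strategy Black t"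
    and s: "\<And>ps. complete_play p ps \<Longrightarrow> follows White s ps \<Longrightarrow> won_by White (last ps)"
    and t: "\<And>ps. complete_play p ps \<Longrightarrow> follows Black t ps \<Longrightarrow> won_by Black (last ps)"
    using assms(2,3) unfolding wins_def by blast
  obtain ps where "complete_play p ps" "follows White s ps" "follows Black t ps"
    using ex_play_following_both[OF st assms(1)] by blast
  then have "won_by White (last ps)" "won_by Black (last ps)"
    using s t by blast+
  then show False
    by simp
qed

section \<open>Winning positions of the two players\<close>

lemma position_sum_2:
  assumes "is_position p" "sum_list p = 2"
  shows "p = [2] \<or> p = [1, 1]"
proof (cases p)
  case (Cons a ys)
  note p = Cons
  show ?thesis
  proof (cases ys)
    case (Cons b zs)
    then show ?thesis
      using assms p by (cases zs) (auto simp: is_position_def)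
  qed (use assms p in auto)
qed (use assms in auto)

text \<open>The invariant White maintains; Black maintains its negation. At the end it separates
  \<open>[2]\<close>, with \<open>Delta\<close> 0, from \<open>[1, 1]\<close>, with
  \<open>Delta\<close> 2.\<close>

definition White_winning :: "nat list \<Rightarrow> bool" where
  "White_winning p \<longleftrightarrow> (if to_move p = White then \<bar>Delta p\<bar> = 1 else Delta p = 0)"

lemma even_Delta_iff_to_move: "even (Delta p) \<longleftrightarrow> to_move p = Black"
  by (simp add: even_Delta_iff to_move_def)

lemma to_move_move: "move p q \<Longrightarrow> to_move q = White \<longleftrightarrow> to_move p \<noteq> White"
  using sum_list_move[of p q] by (simp add: to_move_def)

lemma wins_White:
  assumes "is_position p" "White_winning p"
  shows "wins White p"
  using assms
proof (rule wins_by_invariant)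
  fix p
  assume "is_position p" "2 < sum_list p" "to_move p = White" "White_winning p"
  then show "\<exists>q. move p q \<and> White_winning q"
    using ex_move_Delta_1[of p] to_move_move[of p] by (auto simp: White_winning_def)
next
  fix p q
  assume *: "to_move p \<noteq> White" "White_winning p" "move p q"
  \<comment> \<open>All three values allowed by \<open>move_Delta\<close> are 1 or -1 when
    \<open>Delta p = 0\<close>.\<close>
  then have "\<bar>Delta q\<bar> = 1"
    using move_Delta[of p q] by (auto simp: White_winning_def)
  then show "White_winning q"
    using * to_move_move[of p q] by (simp add: White_winning_def)
next
  fix p
  assume *: "is_position p" "sum_list p = 2" "White_winning p"
  then show "won_by White p"
    using position_sum_2[of p] by (auto simp: White_winning_def to_move_def)
qed

lemma wins_Black:
  assumes "is_position p" "\<not> White_winning p"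
  shows "wins Black p"
  using assms
proof (rule wins_by_invariant)
  fix p
  assume *: "is_position p" "2 < sum_list p" "to_move p = Black" "\<not> White_winning p"
  then have "Delta p \<noteq> 0" "even (Delta p)"
    by (auto simp: White_winning_def even_Delta_iff_to_move)
  then have "Delta p = 2 \<or> Delta p = - 2 \<or> 4 \<le> \<bar>Delta p\<bar>"
    by presburger
  then consider "Delta p = 2" | "Delta p = - 2" | "4 \<le> \<bar>Delta p\<bar>"
    by blast
  \<comment> \<open>Black aims at absolute value at least 3. From 4 on any legal move keeps this
    bound; only 2 and -2 need a chosen move.\<close>
  then have "\<exists>q. move p q \<and> 3 \<le> \<bar>Delta q\<bar>"
  proof cases
    case 1
    then show ?thesis
      using ex_move_Delta_2[of p] * by auto
  next
    case 2
    then show ?thesis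
      using ex_move_Delta_minus_2[of p] * by auto
  next
    case 3
    obtain q where "move p q"
      using ex_move[of p] * by blast
    then show ?thesis
      using move_abs_Delta[of p q] 3 by auto
  qed
  then show "\<exists>q. move p q \<and> \<not> White_winning q"
    by (fastforce simp: White_winning_def)
next
  fix p q
  assume *: "to_move p \<noteq> Black" "\<not> White_winning p" "move p q"
  then have white: "to_move p = White"
    by (cases "to_move p") auto
  have "odd (Delta p)" "\<bar>Delta p\<bar> \<noteq> 1"
    using * white by (auto simp: White_winning_def even_Delta_iff_to_move)
  \<comment> \<open>One move of White then leaves absolute value at least 2, hence not 0.\<close>
  then have "3 \<le> \<bar>Delta p\<bar>"
    by presburger
  then show "\<not> White_winning q"
    using move_abs_Delta[of p q] to_move_move[of p q] white * by (auto simp: White_winning_def)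
next
  fix p
  assume *: "is_position p" "sum_list p = 2" "\<not> White_winning p"
  then show "won_by Black p"
    using position_sum_2[of p] by (auto simp: White_winning_def to_move_def)
qed

theorem theorem2p3:
  fixes ns :: "nat list"
  assumes "is_position ns"
  shows "(to_move ns = White \<longrightarrow> (wins White ns \<longleftrightarrow> \<bar>Delta ns\<bar> = 1)) \<and>
         (to_move ns = Black \<longrightarrow> (wins Black ns \<longleftrightarrow> \<bar>Delta ns\<bar> \<noteq> 0))"
proof -
  \<comment> \<open>Each position satisfies the invariant or its negation, and both players cannot
    win, so the sufficient conditions are also necessary.\<close>
  have "wins White ns \<longleftrightarrow> White_winning ns" "wins Black ns \<longleftrightarrow> \<not> White_winning ns"
    using wins_White[OF assms] wins_Black[OF assms] not_wins_both[OF assms] by blast+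
  then show ?thesis
    by (auto simp: White_winning_def)
qed

end
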